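(* Let $n$ be a positive integer, let $r_1,\ldots,r_n$ be positive irrational real numbers such that the only integer solution to $x_1 r_1+x_2 r_2+\cdots+x_n r_n=0$ is $x_1=x_2=\cdots=x_n=0$, and let $P_n\subset\mathbb{R}$ be the set constructed from $r_1,\ldots,r_n$ as in the context. Let $Q$ be a subset of $P_n$ of size $k$. Then $|Q-Q|\ge k^{\log_2 3}$.
   Context: For $b\in\mathbb{R}$ and a finite set $A\subset\mathbb{R}$, write $b+A=\{b+a: a\in A\}$ and $A-A=\{a-a' : a,a'\in A\}$. Given $r_1,\ldots,r_n$, define sets $P_j\subset\mathbb{R}$ for $0\le j\le n$ by $P_0=\{1\}$ and $P_j=P_{j-1}\cup(r_j+P_{j-1})$ for $1\le j\le n$; the set $P_j$ consists of $2^j$ real numbers. *)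

theory Defs
  imports Complex_Main
begin

fun shift_set :: "(nat \<Rightarrow> real) \<Rightarrow> nat \<Rightarrow> real set" where
  "shift_set r 0 = {1}"
| "shift_set r (Suc j) = shift_set r j \<union> (+) (r (Suc j)) ` shift_set r j"

text \<open>On sets, infix \<open>-\<close> is set-theoretic difference, so the algebraic difference set
  gets its own name.\<close>

definition difference_set :: "real set \<Rightarrow> real set" where
  "difference_set A = {a - a' | a a'. a \<in> A \<and> a' \<in> A}"

end

theory Submission
  imports Defs "HOL-Analysis.Convex"
begin

text \<open>
  For the two-set version \<open>|A - B| \<ge> (|A| |B|)\<^sup>p\<close> with \<open>p = log\<^sub>4 3\<close>, split \<open>A\<close> and \<open>B\<close> according
  to whether \<open>r\<^sub>n\<close> is used: \<open>A = A\<^sub>0 \<union> (r\<^sub>n + A\<^sub>1)\<close>, \<open>B = B\<^sub>0 \<union> (r\<^sub>n + B\<^sub>1)\<close>. By independence the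
  differences with \<open>r\<^sub>n\<close>-coefficient \<open>0\<close>, \<open>1\<close>, \<open>-1\<close> are distinct, so \<open>|A - B|\<close> is at least
  \<open>max |A\<^sub>i - B\<^sub>i| + |A\<^sub>1 - B\<^sub>0| + |A\<^sub>0 - B\<^sub>1|\<close>. After normalization the induction step becomes
  \<open>((1 + x) (1 + y))\<^sup>p \<le> 1 + x\<^sup>p + y\<^sup>p\<close> for \<open>x y \<le> 1\<close>. For fixed \<open>y\<close> the right side minus the left
  side first increases and then decreases in \<open>x\<close>, which reduces the claim to \<open>x = 0\<close> and to
  \<open>x = 1 / y\<close>; the latter case is settled by a second argument of the same kind in \<open>y\<close>.
\<close>

section \<open>Inequalities for real powers\<close>

text \<open>A negative value inside would, by the mean value theorem, force a negative derivative
  somewhere to its left and a positive one to its right, which \<open>sign\<close> forbids.\<close>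

lemma nonneg_if_deriv_changes_sign_once:
  fixes f f' :: "real \<Rightarrow> real"
  assumes cont: "continuous_on {a..b} f"
    and deriv: "\<And>x. a < x \<Longrightarrow> x < b \<Longrightarrow> (f has_real_derivative f' x) (at x)"
    and sign: "\<And>x z. a < x \<Longrightarrow> x < z \<Longrightarrow> z < b \<Longrightarrow> f' x < 0 \<Longrightarrow> f' z \<le> 0"
    and ends: "f a \<ge> 0" "f b \<ge> 0"
    and y: "a \<le> y" "y \<le> b"
  shows "f y \<ge> 0"
proof (rule ccontr)
  assume neg: "\<not> f y \<ge> 0"
  with ends y have ay: "a < y" "y < b"
    by (metis order_le_less)+
  obtain u where u: "a < u" "u < y" "f y - f a = (y - a) * f' u"
  proof (rule MVT[OF ay(1), of f, elim_format])
    show "continuous_on {a..y} f"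
      using cont by (rule continuous_on_subset) (use ay in auto)
    show "f differentiable (at x)" if "a < x" "x < y" for x
      using deriv[of x] that ay by (auto simp: real_differentiable_def)
  next
    assume "\<exists>l z. a < z \<and> z < y \<and> (f has_real_derivative l) (at z) \<and> f y - f a = (y - a) * l"
    then show thesis
      using that deriv ay by (metis DERIV_unique less_trans)
  qed
  obtain v where v: "y < v" "v < b" "f b - f y = (b - y) * f' v"
  proof (rule MVT[OF ay(2), of f, elim_format])
    show "continuous_on {y..b} f"
      using cont by (rule continuous_on_subset) (use ay in auto)
    show "f differentiable (at x)" if "y < x" "x < b" for x
      using deriv[of x] that ay by (auto simp: real_differentiable_def)
  next
    assume "\<exists>l z. y < z \<and> z < b \<and> (f has_real_derivative l) (at z) \<and> f b - f y = (b - y) * l"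
    then show thesis
      using that deriv ay by (metis DERIV_unique less_trans)
  qed
  have "(y - a) * f' u < 0"
    using neg ends u by linarith
  then have "f' u < 0"
    using ay by (simp add: mult_less_0_iff)
  then have "f' v \<le> 0"
    using sign[of u v] u v ay by linarith
  then have "(b - y) * f' v \<le> 0"
    using ay by (simp add: mult_nonneg_nonpos)
  then show False
    using neg ends v by linarith
qed

text \<open>The fractions \<open>1 / (1 + y)\<close> and \<open>y / (1 + y)\<close> add up to 1, and
  raising a number in [0, 1] to the power \<open>p\<close> does not decrease it.\<close>

lemma powr_add_one_le:
  fixes y p :: real
  assumes "0 \<le> y" "0 < p" "p \<le> 1"
  shows "(1 + y) powr p \<le> 1 + y powr p"
proof -
  have le: "u \<le> u powr p" if "0 \<le> u" "u \<le> 1" for u :: real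
    using that assms powr_mono'[of p 1 u] by simp
  have "1 = 1 / (1 + y) + y / (1 + y)"
    using assms by (simp flip: add_divide_distrib)
  also have "\<dots> \<le> (1 / (1 + y)) powr p + (y / (1 + y)) powr p"
    using assms by (intro add_mono le) auto
  also have "\<dots> = (1 + y powr p) / (1 + y) powr p"
    using assms by (simp add: powr_divide add_divide_distrib)
  finally show ?thesis
    using assms by (simp add: pos_le_divide_eq)
qed

text \<open>This function carries the sign of the derivative of
  \<open>ln (1 + y\<^sup>p + y\<^bsup>2p\<^esup>) - 2 p ln (1 + y)\<close>.\<close>

lemma convex_on_sign_factor:
  fixes p :: real
  assumes "1/2 < p" "p < 1"
  shows "convex_on {0<..1} (\<lambda>y. 1 + 2 * y powr p - y - 2 * y powr (1 - p))"
proof (rule f''_ge0_imp_convex)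
  fix y :: real
  assume y: "y \<in> {0<..1}"
  show "((\<lambda>y. 1 + 2 * y powr p - y - 2 * y powr (1 - p)) has_real_derivative
      2 * p * y powr (p - 1) - 1 - 2 * (1 - p) * y powr (- p)) (at y)"
    using y by (auto intro!: derivative_eq_intros)
  show "((\<lambda>y. 2 * p * y powr (p - 1) - 1 - 2 * (1 - p) * y powr (- p)) has_real_derivative
      2 * p * (1 - p) * (y powr (- p - 1) - y powr (p - 2))) (at y)"
    using y by (auto intro!: derivative_eq_intros simp: algebra_simps)
  \<comment> \<open>Here \<open>- p - 1 \<le> p - 2\<close> because \<open>p > 1/2\<close>; a base
    in (0, 1] reverses the order.\<close>
  have "y powr (p - 2) \<le> y powr (- p - 1)"
    using y assms by (intro powr_mono') auto
  then show "0 \<le> 2 * p * (1 - p) * (y powr (- p - 1) - y powr (p - 2))"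
    using assms by simp
qed (rule convex_real_interval)

text \<open>Logarithms turn the claim into \<open>f y \<ge> 0\<close>, where \<open>f\<close>
  vanishes at 0 and, by \<open>4 powr p = 3\<close>, at 1. As \<open>\<psi>\<close> is convex with
  \<open>\<psi> 1 = 0\<close>, once negative it stays nonpositive up to 1.\<close>

lemma powr_square_le_unit:
  fixes y p :: real
  assumes p: "1/2 < p" "p < 1" "4 powr p = 3" and y: "0 \<le> y" "y \<le> 1"
  shows "(1 + y) powr (2 * p) \<le> 1 + y powr p + y powr (2 * p)"
proof -
  define \<psi> where "\<psi> = (\<lambda>y. 1 + 2 * y powr p - y - 2 * y powr (1 - p))"
  define f where "f = (\<lambda>y. ln (1 + y powr p + y powr (2 * p)) - 2 * p * ln (1 + y))"
  define f' where "f' = (\<lambda>y. p * y powr (p - 1) * \<psi> y / ((1 + y powr p + y powr (2 * p)) * (1 + y)))"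
  have pos: "1 + x powr p + x powr (2 * p) > 0" for x :: real
    by (simp add: add_pos_nonneg)
  have psi: "f' x < 0 \<longleftrightarrow> \<psi> x < 0" "f' x \<le> 0 \<longleftrightarrow> \<psi> x \<le> 0" if "0 < x" for x
    using that p pos[of x]
    by (auto simp: f'_def divide_less_0_iff divide_le_0_iff mult_less_0_iff mult_le_0_iff
        zero_less_mult_iff)
  have "f y \<ge> 0"
  proof (rule nonneg_if_deriv_changes_sign_once[of 0 1 f f'])
    show "continuous_on {0..1} f"
      unfolding f_def using p pos
      by (intro continuous_intros continuous_on_powr') (auto simp: less_imp_neq[symmetric])
    show "(f has_real_derivative f' x) (at x)" if "0 < x" "x < 1" for x
    proof -
      have powrs: "x powr p = x * x powr (p - 1)" "x powr (2 * p) = x * (x * (x powr (p - 1))^2)"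
          "x powr (2 * p - 1) = x * (x powr (p - 1))^2" "x powr (p - 1) * x powr (1 - p) = 1"
        using that by (simp_all add: power2_eq_square powr_mult_base flip: powr_add)
      have ne: "1 + x powr p + x powr (2 * p) \<noteq> 0" "1 + x \<noteq> 0"
        using pos[of x] that by auto
      have "p * x powr (p - 1) + 2 * p * x powr (2 * p - 1) =
          p * x powr (p - 1) * (1 + 2 * x powr p)"
        unfolding powrs by (simp add: algebra_simps power2_eq_square)
      moreover have "p * x powr (p - 1) * (1 + 2 * x powr p) * (1 + x)
          - 2 * p * (1 + x powr p + x powr (2 * p)) = p * x powr (p - 1) * \<psi> x"
      proof -
        \<comment> \<open>Inserting this factor, equal to 1, lets \<open>x powr (p - 1)\<close> be
          pulled out of every term.\<close>
        have "2 * p = 2 * p * (x powr (p - 1) * x powr (1 - p))"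
          using powrs by simp
        then show ?thesis
          unfolding \<psi>_def powrs(1,2) by (simp add: algebra_simps power2_eq_square)
      qed
      ultimately have "(p * x powr (p - 1) + 2 * p * x powr (2 * p - 1)) / (1 + x powr p + x powr (2 * p))
          - 2 * p / (1 + x) = f' x"
        using ne by (simp add: diff_frac_eq f'_def)
      moreover have "(f has_real_derivative
          (p * x powr (p - 1) + 2 * p * x powr (2 * p - 1)) / (1 + x powr p + x powr (2 * p))
          - 2 * p / (1 + x)) (at x)"
        unfolding f_def using that pos[of x] by (auto intro!: derivative_eq_intros)
      ultimately show ?thesis by simp
    qed
    show "f' z \<le> 0" if "0 < x" "x < z" "z < 1" "f' x < 0" for x z
    proof -
      have c: "convex_on {0<..1} \<psi>"
        unfolding \<psi>_def using p by (intro convex_on_sign_factor)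
      define t where "t = (z - x) / (1 - x)"
      have t: "0 \<le> t" "t \<le> 1" "(1 - t) * x + t * 1 = z"
      proof -
        have "t * (1 - x) = z - x"
          using that by (simp add: t_def)
        then show "(1 - t) * x + t * 1 = z"
          by (simp add: algebra_simps)
      qed (use that in \<open>auto simp: t_def\<close>)
      have "\<psi> z \<le> (1 - t) * \<psi> x + t * \<psi> 1"
        using convex_onD[OF c t(1,2), of x 1] that t(3) by simp
      also have "\<psi> 1 = 0"
        by (simp add: \<psi>_def)
      also have "(1 - t) * \<psi> x + t * 0 \<le> 0"
        using that psi t by (simp add: mult_nonneg_nonpos)
      finally show ?thesis
        using psi that by simp
    qed
    have "ln 3 = p * ln 4"
      using p(3) ln_powr[of 4 p] by simp
    also have "ln (4::real) = 2 * ln 2"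
      using ln_realpow[of 2 2] by simp
    finally show "f 1 \<ge> 0"
      by (simp add: f_def)
    show "f 0 \<ge> 0"
      by (simp add: f_def)
  qed (use y in auto)
  then have "ln ((1 + y) powr (2 * p)) \<le> ln (1 + y powr p + y powr (2 * p))"
    using y by (simp add: f_def ln_powr)
  moreover have "0 < (1 + y) powr (2 * p)"
    using y by simp
  ultimately show ?thesis
    using pos[of y] ln_le_cancel_iff by blast
qed

text \<open>Replacing \<open>y\<close> by \<open>1 / y\<close> and multiplying by
  \<open>y powr (2 * p)\<close> reproduces the inequality, so \<open>y > 1\<close> reduces to the
  unit interval.\<close>

lemma powr_square_le:
  fixes y p :: real
  assumes p: "1/2 < p" "p < 1" "4 powr p = 3" and y: "0 < y"
  shows "(1 + y) powr (2 * p) \<le> 1 + y powr p + y powr (2 * p)"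
proof (cases "y \<le> 1")
  case True
  then show ?thesis
    using assms by (intro powr_square_le_unit) auto
next
  case False
  have "(1 + y) powr (2 * p) = (1 + 1 / y) powr (2 * p) * y powr (2 * p)"
    using y by (simp add: distrib_right add.commute flip: powr_mult)
  also have "\<dots> \<le> (1 + (1 / y) powr p + (1 / y) powr (2 * p)) * y powr (2 * p)"
    using assms False by (intro mult_right_mono powr_square_le_unit) auto
  also have "\<dots> = 1 + y powr p + y powr (2 * p)"
    using y by (simp add: powr_divide field_simps flip: powr_add)
  finally show ?thesis .
qed

text \<open>The derivative in \<open>x\<close> has the sign of \<open>g\<close>, which decreases for
  positive \<open>x\<close>. Hence only the endpoints 0 and \<open>1 / y\<close> need
  checking.\<close>

lemma powr_mult_le_normalized:
  fixes x y p :: real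
  assumes p: "1/2 < p" "p < 1" "4 powr p = 3" and xy: "0 \<le> x" "0 \<le> y" "x * y \<le> 1"
  shows "((1 + x) * (1 + y)) powr p \<le> 1 + x powr p + y powr p"
proof (cases "y = 0")
  case True
  then show ?thesis
    using powr_add_one_le[of x p] assms by simp
next
  case False
  with xy have y: "0 < y" by simp
  define f where "f = (\<lambda>x. 1 + x powr p + y powr p - (1 + x) powr p * (1 + y) powr p)"
  define g where "g = (\<lambda>x. 1 - (1 + y) powr p * (1 + 1 / x) powr (p - 1))"
  define f' where "f' = (\<lambda>x. p * x powr (p - 1) * g x)"
  have sgn: "f' x < 0 \<longleftrightarrow> g x < 0" "f' x \<le> 0 \<longleftrightarrow> g x \<le> 0" if "0 < x" for x
    using that p by (auto simp: f'_def mult_less_0_iff mult_le_0_iff)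
  have "f x \<ge> 0"
  proof (rule nonneg_if_deriv_changes_sign_once[of 0 "1 / y" f f'])
    show "continuous_on {0..1 / y} f"
      unfolding f_def using p by (intro continuous_intros continuous_on_powr') auto
    show "(f has_real_derivative f' x) (at x)" if "0 < x" "x < 1 / y" for x
    proof -
      have "(1 + x) powr (p - 1) = x powr (p - 1) * (1 + 1 / x) powr (p - 1)"
        using that by (simp add: distrib_left add.commute flip: powr_mult)
      then show ?thesis
        unfolding f_def using that
        by (auto intro!: derivative_eq_intros simp: f'_def g_def algebra_simps)
    qed
    show "f' z \<le> 0" if "0 < x" "x < z" "z < 1 / y" "f' x < 0" for x z
    proof -
      have "(1 + 1 / x) powr (p - 1) \<le> (1 + 1 / z) powr (p - 1)"
        using that p by (intro powr_mono2') (auto simp: frac_le add_pos_pos)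
      then have "g z \<le> g x"
        by (simp add: g_def mult_left_mono)
      then show ?thesis
        using sgn that by force
    qed
    show "f 0 \<ge> 0"
      using powr_add_one_le[of y p] p xy by (simp add: f_def)
    \<comment> \<open>At \<open>x = 1 / y\<close>, multiplying the claim by \<open>y powr p\<close>
      gives exactly \<open>powr_square_le\<close>.\<close>
    have "(1 + 1 / y) powr p * (1 + y) powr p = (1 + y) powr (2 * p) / y powr p"
    proof -
      have "1 + 1 / y = (1 + y) / y"
        using y by (simp add: field_simps)
      then show ?thesis
        using y by (simp add: powr_divide flip: powr_add)
    qed
    also have "\<dots> \<le> (1 + y powr p + y powr (2 * p)) / y powr p"
      using powr_square_le[OF p y] by (intro divide_right_mono) auto
    also have "\<dots> = 1 + (1 / y) powr p + y powr p"
      using y by (simp add: powr_divide field_simps flip: powr_add)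
    finally show "f (1 / y) \<ge> 0"
      by (simp add: f_def)
  qed (use xy y in \<open>auto simp: field_simps\<close>)
  then show ?thesis
    using xy by (simp add: f_def powr_mult)
qed

text \<open>By homogeneity, dividing by \<open>a0 * b0\<close> leaves the normalized case with
  \<open>x = a1 / a0\<close> and \<open>y = b1 / b0\<close>.\<close>

lemma powr_mult_le:
  fixes a0 a1 b0 b1 p :: real
  assumes p: "1/2 < p" "p < 1" "4 powr p = 3"
    and nonneg: "0 \<le> a0" "0 \<le> a1" "0 \<le> b0" "0 \<le> b1" and le: "a1 * b1 \<le> a0 * b0"
  shows "((a0 + a1) * (b0 + b1)) powr p \<le> (a0 * b0) powr p + (a1 * b0) powr p + (a0 * b1) powr p"
proof (cases "a0 = 0 \<or> b0 = 0")
  \<comment> \<open>With \<open>a1 * b1 = 0\<close> the left product collapses to a single mixed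
    term, which also occurs on the right.\<close>
  case True
  with le nonneg have "a1 * b1 = 0"
    by (metis antisym mult_nonneg_nonneg mult_zero_left mult_zero_right)
  with True show ?thesis
    by (auto simp: algebra_simps)
next
  case False
  with nonneg have pos: "0 < a0" "0 < b0" by auto
  have "((a0 + a1) * (b0 + b1)) powr p = ((a0 * b0) * ((1 + a1 / a0) * (1 + b1 / b0))) powr p"
  proof -
    have "a0 + a1 = a0 * (1 + a1 / a0)" "b0 + b1 = b0 * (1 + b1 / b0)"
      using pos by (simp_all add: distrib_left)
    then show ?thesis
      by (metis mult.assoc mult.left_commute)
  qed
  also have "\<dots> = (a0 * b0) powr p * ((1 + a1 / a0) * (1 + b1 / b0)) powr p"
    by (rule powr_mult)
  also have "\<dots> \<le> (a0 * b0) powr p * (1 + (a1 / a0) powr p + (b1 / b0) powr p)"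
    using pos nonneg le by (intro mult_left_mono powr_mult_le_normalized p) auto
  also have "\<dots> = (a0 * b0) powr p + (a0 * b0 * (a1 / a0)) powr p + (a0 * b0 * (b1 / b0)) powr p"
    using pos nonneg by (subst (3 4) powr_mult) (auto simp: distrib_left)
  also have "\<dots> = (a0 * b0) powr p + (a1 * b0) powr p + (a0 * b1) powr p"
    using pos by (simp add: mult_ac)
  finally show ?thesis .
qed

section \<open>Differences of two sets\<close>

text \<open>Two sets are allowed because splitting even \<open>A - A\<close> produces mixed
  differences, so the induction has to run over pairs.\<close>

definition diffs :: "real set \<Rightarrow> real set \<Rightarrow> real set" where
  "diffs A B = (\<lambda>(a, b). a - b) ` (A \<times> B)"

lemma finite_diffs: "finite A \<Longrightarrow> finite B \<Longrightarrow> finite (diffs A B)"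
  by (simp add: diffs_def)

lemma diffs_Un_left: "diffs (A \<union> A') B = diffs A B \<union> diffs A' B"
  by (auto simp: diffs_def)

lemma diffs_Un_right: "diffs A (B \<union> B') = diffs A B \<union> diffs A B'"
  by (auto simp: diffs_def)

lemma diffs_shift_left: "diffs ((+) c ` A) B = (+) c ` diffs A B"
  by (force simp: diffs_def image_iff)

lemma diffs_shift_right: "diffs A ((+) c ` B) = (+) (- c) ` diffs A B"
  by (force simp: diffs_def image_iff)

lemma difference_set_eq_diffs: "difference_set A = diffs A A"
  by (auto simp: difference_set_def diffs_def)

section \<open>Integer independence and the structure of \<open>shift_set\<close>\<close>

lemma finite_shift_set: "finite (shift_set r n)"
  by (induction n) auto

lemma shift_set_representation:
  "a \<in> shift_set r n \<Longrightarrow> \<exists>x :: nat \<Rightarrow> int. a = 1 + (\<Sum>i = 1..n. real_of_int (x i) * r i)"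
proof (induction n arbitrary: a)
  case 0
  then show ?case by simp
next
  case (Suc n)
  from Suc.prems obtain e :: int and a' where a': "a' \<in> shift_set r n" "a = e * r (Suc n) + a'"
    by (auto intro: that[of _ 0] that[of _ 1])
  from Suc.IH[OF a'(1)] obtain x :: "nat \<Rightarrow> int"
    where "a' = 1 + (\<Sum>i = 1..n. real_of_int (x i) * r i)" by blast
  with a' have "a = 1 + (\<Sum>i = 1..Suc n. real_of_int ((x(Suc n := e)) i) * r i)"
    by simp
  then show ?case by blast
qed

text \<open>This is linear independence over the rationals, with denominators cleared.\<close>

definition int_independent :: "(nat \<Rightarrow> real) \<Rightarrow> nat \<Rightarrow> bool" where
  "int_independent r n \<longleftrightarrow>
    (\<forall>x :: nat \<Rightarrow> int. (\<Sum>i = 1..n. real_of_int (x i) * r i) = 0 \<longrightarrow> (\<forall>i\<in>{1..n}. x i = 0))"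

lemma int_independent_Suc:
  assumes "int_independent r (Suc n)"
  shows "int_independent r n"
  unfolding int_independent_def
proof (intro allI impI)
  fix x :: "nat \<Rightarrow> int"
  assume "(\<Sum>i = 1..n. real_of_int (x i) * r i) = 0"
  then have "(\<Sum>i = 1..Suc n. real_of_int ((x(Suc n := 0)) i) * r i) = 0"
    by simp
  with assms have zero: "\<forall>i\<in>{1..Suc n}. (x(Suc n := 0)) i = 0"
    unfolding int_independent_def by blast
  show "\<forall>i\<in>{1..n}. x i = 0"
  proof
    fix i
    assume "i \<in> {1..n}"
    then have "i \<in> {1..Suc n}" "i \<noteq> Suc n"
      by auto
    with bspec[OF zero this(1)] show "x i = 0" by simp
  qed
qed

text \<open>The constants 1 cancel in both differences, so the equation is an integer relation in
  which \<open>r (Suc n)\<close> has coefficient \<open>e\<close>.\<close>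

lemma shift_set_no_collision:
  assumes indep: "int_independent r (Suc n)"
    and mem: "a \<in> shift_set r n" "b \<in> shift_set r n" "c \<in> shift_set r n" "d \<in> shift_set r n"
    and eq: "of_int e * r (Suc n) + (a - b) = c - d"
  shows "e = 0"
proof -
  obtain x where x: "a = 1 + (\<Sum>i = 1..n. real_of_int (x i) * r i)"
    using shift_set_representation[OF mem(1)] by blast
  obtain y where y: "b = 1 + (\<Sum>i = 1..n. real_of_int (y i) * r i)"
    using shift_set_representation[OF mem(2)] by blast
  obtain z where z: "c = 1 + (\<Sum>i = 1..n. real_of_int (z i) * r i)"
    using shift_set_representation[OF mem(3)] by blast
  obtain w where w: "d = 1 + (\<Sum>i = 1..n. real_of_int (w i) * r i)"
    using shift_set_representation[OF mem(4)] by blast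
  define t where "t = (\<lambda>i. x i - y i - z i + w i)(Suc n := e)"
  have "(\<Sum>i = 1..Suc n. real_of_int (t i) * r i)
      = (\<Sum>i = 1..n. real_of_int (x i - y i - z i + w i) * r i) + of_int e * r (Suc n)"
    by (simp add: t_def)
  also have "\<dots> = 0"
    using eq unfolding x y z w by (simp add: algebra_simps sum.distrib sum_subtractf)
  finally have "\<forall>i\<in>{1..Suc n}. t i = 0"
    using indep unfolding int_independent_def by blast
  then have "t (Suc n) = 0" by simp
  then show ?thesis by (simp add: t_def)
qed

lemma shift_set_split:
  assumes indep: "int_independent r (Suc n)" and A: "A \<subseteq> shift_set r (Suc n)"
  obtains A0 A1 where "A0 \<subseteq> shift_set r n" "A1 \<subseteq> shift_set r n"
    "A = A0 \<union> (+) (r (Suc n)) ` A1" "card A = card A0 + card A1"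
proof
  let ?S = "shift_set r n" and ?s = "r (Suc n)"
  let ?A0 = "A \<inter> ?S" and ?A1 = "{a \<in> ?S. ?s + a \<in> A}"
  show "?A0 \<subseteq> ?S" "?A1 \<subseteq> ?S" by auto
  show A_eq: "A = ?A0 \<union> (+) ?s ` ?A1"
    using A by auto
  have "?A0 \<inter> (+) ?s ` ?A1 = {}"
    \<comment> \<open>An overlap \<open>?s + a = c\<close> is read as
      \<open>1 * ?s + (a - b) = c - b\<close>.\<close>
    using shift_set_no_collision[OF indep, of _ _ _ _ 1] by force
  then have "card (?A0 \<union> (+) ?s ` ?A1) = card ?A0 + card ((+) ?s ` ?A1)"
    by (intro card_Un_disjoint) (auto simp: finite_shift_set)
  then show "card A = card ?A0 + card ?A1"
    by (simp add: card_image flip: A_eq)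
qed

section \<open>Induction for the cardinality bound\<close>

lemma card_diffs_lower_bound:
  fixes p :: real
  assumes p: "1/2 < p" "p < 1" "4 powr p = 3"
  shows "int_independent r n \<Longrightarrow> A \<subseteq> shift_set r n \<Longrightarrow> B \<subseteq> shift_set r n \<Longrightarrow>
    (real (card A) * real (card B)) powr p \<le> real (card (diffs A B))"
proof (induction n arbitrary: A B)
  case 0
  then have "A = {} \<or> A = {1}" "B = {} \<or> B = {1}" by auto
  then show ?case by (auto simp: diffs_def)
next
  case (Suc n)
  let ?S = "shift_set r n" and ?s = "r (Suc n)"
  obtain A0 A1 where A: "A0 \<subseteq> ?S" "A1 \<subseteq> ?S" "A = A0 \<union> (+) ?s ` A1" "card A = card A0 + card A1"
    using shift_set_split[OF Suc.prems(1,2)] .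
  obtain B0 B1 where B: "B0 \<subseteq> ?S" "B1 \<subseteq> ?S" "B = B0 \<union> (+) ?s ` B1" "card B = card B0 + card B1"
    using shift_set_split[OF Suc.prems(1,3)] .
  have IH: "(real (card X) * real (card Y)) powr p \<le> real (card (diffs X Y))"
    if "X \<subseteq> ?S" "Y \<subseteq> ?S" for X Y
    using Suc.IH[OF int_independent_Suc[OF Suc.prems(1)] that] .
  \<comment> \<open>These collect the differences with \<open>?s\<close>-coefficient 0, 1 and
    -1.\<close>
  let ?U = "diffs A0 B0 \<union> diffs A1 B1" and ?V = "(+) ?s ` diffs A1 B0" and ?W = "(+) (- ?s) ` diffs A0 B1"
  have fin: "finite A0" "finite A1" "finite B0" "finite B1"
    using A B finite_shift_set by (auto intro: finite_subset)
  then have finD: "finite ?U" "finite ?V" "finite ?W"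
    by (auto intro: finite_diffs)
  have no_collision: "e = 0" if "u \<in> diffs ?S ?S" "v \<in> diffs ?S ?S" "of_int e * ?s + u = v" for e :: int and u v
    using that shift_set_no_collision[OF Suc.prems(1)] by (auto simp: diffs_def)
  have sub: "diffs X Y \<subseteq> diffs ?S ?S" if "X \<subseteq> ?S" "Y \<subseteq> ?S" for X Y
    using that by (auto simp: diffs_def)
  have subs: "?U \<subseteq> diffs ?S ?S" "diffs A1 B0 \<subseteq> diffs ?S ?S" "diffs A0 B1 \<subseteq> diffs ?S ?S"
    using sub A B by auto
  have "?U \<inter> ?V = {}"
    using no_collision[of _ _ 1] subs by fastforce
  moreover have "?U \<inter> ?W = {}"
    using no_collision[of _ _ "-1"] subs by fastforce
  moreover have "?V \<inter> ?W = {}"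
  proof -
    \<comment> \<open>Moving \<open>- ?s\<close> across gives coefficient 2.\<close>
    have False if "v \<in> diffs A1 B0" "w \<in> diffs A0 B1" "?s + v = - ?s + w" for v w
      using no_collision[of v w 2] that subs by auto
    then show ?thesis by blast
  qed
  moreover have D: "diffs A B = ?U \<union> ?V \<union> ?W"
    unfolding A(3) B(3) diffs_Un_left diffs_Un_right diffs_shift_left diffs_shift_right
    by (simp add: image_Un image_image Un_ac)
  ultimately have "card (diffs A B) = card ?U + card (diffs A1 B0) + card (diffs A0 B1)"
    unfolding D using finD by (simp add: card_Un_disjoint card_image Int_Un_distrib2)
  moreover have "card (diffs A0 B0) \<le> card ?U" "card (diffs A1 B1) \<le> card ?U"
    using finD by (auto intro!: card_mono)
  \<comment> \<open>The two parts of \<open>?U\<close> may overlap, so just one of them is counted,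
    and either choice is kept available.\<close>
  ultimately have bound: "real (card (diffs X Y)) + card (diffs A1 B0) + card (diffs A0 B1) \<le> card (diffs A B)"
    if "X = A0 \<and> Y = B0 \<or> X = A1 \<and> Y = B1" for X Y
    using that by auto
  show ?case
  \<comment> \<open>The pair with the larger product is counted, as the side condition of
    \<open>powr_mult_le\<close> demands; the second case exchanges the indices 0 and 1.\<close>
  proof (cases "card A1 * card B1 \<le> card A0 * card B0")
    case True
    then have "real (card A1) * card B1 \<le> real (card A0) * card B0"
      by (metis of_nat_le_iff of_nat_mult)
    then have "(real (card A) * card B) powr p
        \<le> (real (card A0) * card B0) powr p + (real (card A1) * card B0) powr p + (real (card A0) * card B1) powr p"
      using powr_mult_le[OF p, of "card A0" "card A1" "card B0" "card B1"] A B by simp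
    then show ?thesis
      using bound[of A0 B0] IH[OF A(1) B(1)] IH[OF A(2) B(1)] IH[OF A(1) B(2)] by simp
  next
    case False
    then have "real (card A0) * card B0 \<le> real (card A1) * card B1"
      by (metis nat_le_linear of_nat_le_iff of_nat_mult)
    then have "(real (card A) * card B) powr p
        \<le> (real (card A1) * card B1) powr p + (real (card A0) * card B1) powr p + (real (card A1) * card B0) powr p"
      using powr_mult_le[OF p, of "card A1" "card A0" "card B1" "card B0"] A B by (simp add: add.commute)
    then show ?thesis
      using bound[of A1 B1] IH[OF A(2) B(2)] IH[OF A(2) B(1)] IH[OF A(1) B(2)] by simp
  qed
qed

theorem lemma2p3:
  fixes n k :: nat and r :: "nat \<Rightarrow> real" and Q :: "real set"
  assumes "n \<ge> 1"
    and "\<And>i. i \<in> {1..n} \<Longrightarrow> r i > 0"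
    and "\<And>i. i \<in> {1..n} \<Longrightarrow> r i \<notin> \<rat>"
    and "\<And>x :: nat \<Rightarrow> int. (\<Sum>i = 1..n. real_of_int (x i) * r i) = 0 \<Longrightarrow> (\<forall>i\<in>{1..n}. x i = 0)"
    and "Q \<subseteq> shift_set r n"
    and "card Q = k"
  shows "real (card (difference_set Q)) \<ge> real k powr (log 2 3)"
proof -
  \<comment> \<open>For \<open>A = B = Q\<close> the product of the sizes is the square of
    \<open>k\<close>, so the exponent is half of \<open>log 2 3\<close>.\<close>
  define p :: real where "p = log 4 3"
  have "log 2 (4::real) = 2"
    using log_pow_cancel[of 2 2] by simp
  then have log: "log 2 3 = p + p"
    using log_base_change[of 2 4 3] by (simp add: p_def)
  have "(4::real) powr (1/2) < 3"
    by (simp add: powr_half_sqrt)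
  then have "1/2 < p"
    unfolding p_def by (subst less_log_iff) auto
  moreover have "p < 1" "4 powr p = 3"
    by (simp_all add: p_def)
  moreover have "int_independent r n"
    using assms(4) unfolding int_independent_def by blast
  ultimately have "(real k * real k) powr p \<le> real (card (difference_set Q))"
    using card_diffs_lower_bound[of p r n Q Q] assms by (simp add: difference_set_eq_diffs)
  then show ?thesis
    by (simp add: log powr_mult flip: powr_add)
qed

end
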